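(* Let $X$ be a Banach space. Given $c>0$, consider the following conditions: $(i_c)$ $\widehat{\operatorname{d}}(\operatorname{clust}_{w^*}(x_n),X)\le c\,\delta(x_n)$ for each bounded sequence $(x_n)$ in $X$; $(ii_c)$ $\operatorname{dist}(\operatorname{clust}_{w^*}(x_n),X)\le c\,\delta(x_n)$ for each bounded sequence $(x_n)$ in $X$; $(iii_c)$ $\operatorname{dist}(\operatorname{clust}_{w^*}(x_n),X)\le c\,\widetilde\delta(x_n)$ for each bounded sequence $(x_n)$ in $X$; $(iv_c)$ $\operatorname{wck}(A)\le c\,\beta_w(A)$ for each bounded set $A\subset X$. Then for each $c>0$ we have $$(i_c)\implies(ii_c)\iff(iii_c)\iff(iv_c)\implies(i_{2c}).$$
   Context: $X$ is a real or complex Banach space, canonically embedded in its bidual $X^{**}$. For nonempty sets $A,B$ in a Banach space, $\operatorname{dist}(A,B)=\inf\{\|a-b\|: a\in A,b\in B\}$ and $\widehat{\operatorname{d}}(A,B)=\sup\{\operatorname{dist}(a,B): a\in A\}$. For a bounded sequence $(x_n)$ in $X$, $\operatorname{clust}_{w^*}(x_n)$ is the set of all weak$^*$-cluster points of $(x_n)$ in $X^{**}$. For a bounded sequence put $\operatorname{ca}(x_n)=\inf_{n}\operatorname{diam}\{x_k: k\ge n\}$ (also for scalar sequences), $\delta(x_n)=\sup\{\operatorname{ca}(x^*(x_n)): x^*\in B_{X^*}\}$, and $\widetilde\delta(x_n)=\inf\{\delta(x_{n_k}): (n_k)\text{ strictly increasing}\}$. For a nonempty bounded set $A\subset X$: $\operatorname{wck}(A)=\sup\{\operatorname{dist}(\operatorname{clust}_{w^*}(x_n),X):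 (x_n)\text{ a sequence in }A\}$ and $\beta_w(A)=\sup\{\widetilde\delta(x_n): (x_n)\text{ a sequence in }A\}$. *)

theory Defs
  imports "HOL-Analysis.Analysis"
begin

section \<open>Complex Banach spaces and their duals\<close>

text \<open>The dual of a real normed space is the library type of bounded linear maps into the reals.
  The library has no complex normed spaces, so they and their duals are introduced here.\<close>

class complex_normed_vector = real_normed_vector +
  fixes scaleC :: "complex \<Rightarrow> 'a \<Rightarrow> 'a"  (infixr "*\<^sub>C" 75)
  assumes scaleC_add_right: "a *\<^sub>C (x + y) = a *\<^sub>C x + a *\<^sub>C y"
    and scaleC_add_left: "(a + b) *\<^sub>C x = a *\<^sub>C x + b *\<^sub>C x"
    and scaleC_scaleC: "a *\<^sub>C b *\<^sub>C x = (a * b) *\<^sub>C x"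
    and scaleC_of_real: "complex_of_real r *\<^sub>C x = r *\<^sub>R x"
    and norm_scaleC: "norm (a *\<^sub>C x) = cmod a * norm x"

class complex_banach = complex_normed_vector + complete_space

instantiation complex :: complex_banach
begin

definition scaleC_complex :: "complex \<Rightarrow> complex \<Rightarrow> complex"
  where "scaleC_complex a z = a * z"

instance
  by standard
    (simp_all add: scaleC_complex_def algebra_simps norm_mult scaleR_conv_of_real)

end

text \<open>The elements are the bounded real-linear maps into the complex numbers
  that are in addition complex-homogeneous; the norm is the operator norm.\<close>

typedef (overloaded) 'a cdual =
  "{f :: 'a::complex_normed_vector \<Rightarrow>\<^sub>L complex. \<forall>a x. blinfun_apply f (a *\<^sub>C x) = a * blinfun_apply f x}"
  morphisms blinfun_of_cdual Abs_cdual
  by (rule exI[of _ 0]) simp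

setup_lifting type_definition_cdual

lift_definition cdual_apply :: "'a::complex_normed_vector cdual \<Rightarrow> 'a \<Rightarrow> complex"
  is blinfun_apply .

instantiation cdual :: (complex_normed_vector) complex_normed_vector
begin

lift_definition norm_cdual :: "'a cdual \<Rightarrow> real" is norm .

lift_definition zero_cdual :: "'a cdual" is 0 by simp

lift_definition plus_cdual :: "'a cdual \<Rightarrow> 'a cdual \<Rightarrow> 'a cdual" is "(+)"
  by (simp add: blinfun.add_left algebra_simps)

lift_definition minus_cdual :: "'a cdual \<Rightarrow> 'a cdual \<Rightarrow> 'a cdual" is "(-)"
  by (simp add: blinfun.diff_left algebra_simps)

lift_definition uminus_cdual :: "'a cdual \<Rightarrow> 'a cdual" is uminus
  by (simp add: blinfun.minus_left)

lift_definition scaleR_cdual :: "real \<Rightarrow> 'a cdual \<Rightarrow> 'a cdual" is "(*\<^sub>R)"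
  by (simp add: blinfun.scaleR_left)

lift_definition scaleC_cdual :: "complex \<Rightarrow> 'a cdual \<Rightarrow> 'a cdual"
  is "\<lambda>a f. blinfun_compose (blinfun_mult_right a) f"
  by simp

definition dist_cdual :: "'a cdual \<Rightarrow> 'a cdual \<Rightarrow> real"
  where "dist_cdual f g = norm (f - g)"

definition sgn_cdual :: "'a cdual \<Rightarrow> 'a cdual"
  where "sgn_cdual f = inverse (norm f) *\<^sub>R f"

definition uniformity_cdual :: "('a cdual \<times> 'a cdual) filter"
  where "uniformity_cdual = (INF e\<in>{0<..}. principal {(f, g). dist f g < e})"

definition open_cdual :: "'a cdual set \<Rightarrow> bool"
  where "open_cdual S = (\<forall>f\<in>S. \<forall>\<^sub>F (f', g) in uniformity. f' = f \<longrightarrow> g \<in> S)"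

instance
proof
  fix f g h :: "'a cdual" and r s :: real and a b :: complex
  show "f + g + h = f + (g + h)" "f + g = g + f" "0 + f = f" "- f + f = 0" "f - g = f + - g"
    by (transfer; simp)+
  show "r *\<^sub>R (f + g) = r *\<^sub>R f + r *\<^sub>R g" "(r + s) *\<^sub>R f = r *\<^sub>R f + s *\<^sub>R f"
    "r *\<^sub>R s *\<^sub>R f = (r * s) *\<^sub>R f" "1 *\<^sub>R f = f"
    by (transfer; simp add: scaleR_add_right scaleR_add_left)+
  show "dist f g = norm (f - g)" by (rule dist_cdual_def)
  show "sgn f = inverse (norm f) *\<^sub>R f" by (rule sgn_cdual_def)
  show "uniformity = (INF e\<in>{0<..}. principal {(f :: 'a cdual, g). dist f g < e})"
    by (rule uniformity_cdual_def)
  show "open S = (\<forall>f\<in>S. \<forall>\<^sub>F (f', g) in uniformity. f' = f \<longrightarrow> g \<in> S)" for S :: "'a cdual set"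
    by (rule open_cdual_def)
  show "(norm f = 0) = (f = 0)" by transfer simp
  show "norm (f + g) \<le> norm f + norm g" by transfer (rule norm_triangle_ineq)
  show "norm (r *\<^sub>R f) = \<bar>r\<bar> * norm f" by transfer simp
  show "a *\<^sub>C (f + g) = a *\<^sub>C f + a *\<^sub>C g" "(a + b) *\<^sub>C f = a *\<^sub>C f + b *\<^sub>C f"
    "a *\<^sub>C b *\<^sub>C f = (a * b) *\<^sub>C f" "complex_of_real r *\<^sub>C f = r *\<^sub>R f"
    by (transfer; rule blinfun_eqI;
        simp add: blinfun.add_left blinfun.add_right blinfun.scaleR_left algebra_simps
          scaleR_conv_of_real)+
  have le: "norm (a *\<^sub>C f) \<le> cmod a * norm f" for a :: complex and f :: "'a cdual"
  proof transfer
    fix a :: complex and f :: "'a \<Rightarrow>\<^sub>L complex"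
    show "norm (blinfun_compose (blinfun_mult_right a) f) \<le> cmod a * norm f"
      by (rule norm_blinfun_bound)
        (auto simp: norm_mult mult.assoc intro!: mult_left_mono norm_blinfun)
  qed
  show "norm (a *\<^sub>C f) = cmod a * norm f"
  proof (cases "a = 0")
    case True
    moreover have "norm g \<ge> 0" for g :: "'a cdual"
      by transfer simp
    ultimately show ?thesis
      using le[of a f] by (intro antisym) auto
  next
    case False
    then have "inverse a *\<^sub>C a *\<^sub>C f = f"
      by transfer (rule blinfun_eqI, simp)
    with le[of "inverse a" "a *\<^sub>C f"] False have "cmod a * norm f \<le> norm (a *\<^sub>C f)"
      by (simp add: norm_divide field_simps)
    with le[of a f] show ?thesis by simp
  qed
qed

end


section \<open>Canonical embeddings into the bidual\<close>

lift_definition canon :: "'a::real_normed_vector \<Rightarrow> ('a \<Rightarrow>\<^sub>L real) \<Rightarrow>\<^sub>L real"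
  is "\<lambda>x f. blinfun_apply f x"
  by (rule blinfun.bounded_linear_left)

lemma bounded_linear_cdual_apply_left: "bounded_linear (\<lambda>f. cdual_apply f x)"
proof (rule bounded_linear_intro[where K = "norm x"])
  show "cdual_apply (f + g) x = cdual_apply f x + cdual_apply g x" for f g
    by transfer (simp add: blinfun.add_left)
  show "cdual_apply (r *\<^sub>R f) x = r *\<^sub>R cdual_apply f x" for r f
    by transfer (simp add: blinfun.scaleR_left)
  show "norm (cdual_apply f x) \<le> norm f * norm x" for f
    by transfer (rule norm_blinfun)
qed

lift_definition ccanon_blinfun :: "'a::complex_normed_vector \<Rightarrow> 'a cdual \<Rightarrow>\<^sub>L complex"
  is "\<lambda>x f. cdual_apply f x"
  by (rule bounded_linear_cdual_apply_left)

lemma cdual_apply_scaleC_left: "cdual_apply (a *\<^sub>C f) x = a * cdual_apply f x"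
  by transfer simp

lift_definition ccanon :: "'a::complex_normed_vector \<Rightarrow> 'a cdual cdual"
  is ccanon_blinfun
  by (simp add: ccanon_blinfun.rep_eq cdual_apply_scaleC_left)


section \<open>The quantities\<close>

text \<open>To treat both scalar fields at once, the space \<open>'a\<close>, its dual \<open>'d\<close> and its bidual \<open>'b\<close>
  over the scalars \<open>'k\<close> enter through the evaluation maps \<open>ev :: 'd \<Rightarrow> 'a \<Rightarrow> 'k\<close> and
  \<open>ev2 :: 'b \<Rightarrow> 'd \<Rightarrow> 'k\<close> and the canonical embedding \<open>J :: 'a \<Rightarrow> 'b\<close>.

  All infima and suprema are real-valued; for bounded sequences and nonempty bounded sets they
  range over nonempty bounded sets of reals, so the conventions of the library for the empty and
  the unbounded case play no role.\<close>

definition excess :: "'a::metric_space set \<Rightarrow> 'a set \<Rightarrow> real"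
  where "excess A B = (SUP a\<in>A. setdist {a} B)"

definition ca :: "(nat \<Rightarrow> 'a::metric_space) \<Rightarrow> real"
  where "ca x = (INF n. diameter {x k |k. k \<ge> n})"

definition delta ::
    "('d::real_normed_vector \<Rightarrow> 'a \<Rightarrow> 'k::real_normed_field) \<Rightarrow> (nat \<Rightarrow> 'a) \<Rightarrow> real"
  where "delta ev x = (SUP f\<in>cball 0 1. ca (\<lambda>n. ev f (x n)))"

definition delta_sub ::
    "('d::real_normed_vector \<Rightarrow> 'a \<Rightarrow> 'k::real_normed_field) \<Rightarrow> (nat \<Rightarrow> 'a) \<Rightarrow> real"
  where "delta_sub ev x = (INF r\<in>{r :: nat \<Rightarrow> nat. strict_mono r}. delta ev (x \<circ> r))"

text \<open>The topology of a function type is that of pointwise convergence.\<close>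

definition weak_star_topology ::
    "('b \<Rightarrow> 'd \<Rightarrow> 'k::real_normed_field) \<Rightarrow> 'b topology"
  where "weak_star_topology ev2 = pullback_topology UNIV ev2 euclidean"

definition clust ::
    "('b \<Rightarrow> 'd \<Rightarrow> 'k::real_normed_field) \<Rightarrow> ('a \<Rightarrow> 'b) \<Rightarrow> (nat \<Rightarrow> 'a) \<Rightarrow> 'b set"
  where "clust ev2 J x =
    {z. \<forall>U. openin (weak_star_topology ev2) U \<and> z \<in> U \<longrightarrow> (\<exists>\<^sub>F n in sequentially. J (x n) \<in> U)}"

definition wck ::
    "('b::real_normed_vector \<Rightarrow> 'd \<Rightarrow> 'k::real_normed_field) \<Rightarrow> ('a \<Rightarrow> 'b) \<Rightarrow> 'a set \<Rightarrow> real"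
  where "wck ev2 J A = (SUP x\<in>{x. range x \<subseteq> A}. setdist (clust ev2 J x) (range J))"

definition beta_w ::
    "('d::real_normed_vector \<Rightarrow> 'a \<Rightarrow> 'k::real_normed_field) \<Rightarrow> 'a set \<Rightarrow> real"
  where "beta_w ev A = (SUP x\<in>{x. range x \<subseteq> A}. delta_sub ev x)"


section \<open>The conditions\<close>

definition cond_i ::
    "('d::real_normed_vector \<Rightarrow> 'a::real_normed_vector \<Rightarrow> 'k::real_normed_field) \<Rightarrow>
     ('b::real_normed_vector \<Rightarrow> 'd \<Rightarrow> 'k) \<Rightarrow> ('a \<Rightarrow> 'b) \<Rightarrow> real \<Rightarrow> bool"
  where "cond_i ev ev2 J c \<longleftrightarrow>
    (\<forall>x. bounded (range x) \<longrightarrow> excess (clust ev2 J x) (range J) \<le> c * delta ev x)"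

definition cond_ii ::
    "('d::real_normed_vector \<Rightarrow> 'a::real_normed_vector \<Rightarrow> 'k::real_normed_field) \<Rightarrow>
     ('b::real_normed_vector \<Rightarrow> 'd \<Rightarrow> 'k) \<Rightarrow> ('a \<Rightarrow> 'b) \<Rightarrow> real \<Rightarrow> bool"
  where "cond_ii ev ev2 J c \<longleftrightarrow>
    (\<forall>x. bounded (range x) \<longrightarrow> setdist (clust ev2 J x) (range J) \<le> c * delta ev x)"

definition cond_iii ::
    "('d::real_normed_vector \<Rightarrow> 'a::real_normed_vector \<Rightarrow> 'k::real_normed_field) \<Rightarrow>
     ('b::real_normed_vector \<Rightarrow> 'd \<Rightarrow> 'k) \<Rightarrow> ('a \<Rightarrow> 'b) \<Rightarrow> real \<Rightarrow> bool"
  where "cond_iii ev ev2 J c \<longleftrightarrow>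
    (\<forall>x. bounded (range x) \<longrightarrow> setdist (clust ev2 J x) (range J) \<le> c * delta_sub ev x)"

definition cond_iv ::
    "('d::real_normed_vector \<Rightarrow> 'a::real_normed_vector \<Rightarrow> 'k::real_normed_field) \<Rightarrow>
     ('b::real_normed_vector \<Rightarrow> 'd \<Rightarrow> 'k) \<Rightarrow> ('a \<Rightarrow> 'b) \<Rightarrow> real \<Rightarrow> bool"
  where "cond_iv ev ev2 J c \<longleftrightarrow>
    (\<forall>A. A \<noteq> {} \<and> bounded A \<longrightarrow> wck ev2 J A \<le> c * beta_w ev A)"

end

theory Submission
  imports Defs
begin

text \<open>
  Write \<open>D\<close> for the distance of \<open>clust(x\<^sub>n)\<close> to \<open>X\<close>. Cluster points of a subsequence are cluster
  points of the sequence, and they exist by Banach--Alaoglu, so \<open>D\<close> can only grow on passing to a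
  subsequence, while \<open>\<delta>\<close> can only shrink. With the definitions this gives (i) to (ii), the
  equivalence of (ii) and (iii), and (iii) to (iv). For (iv) to (ii) apply (iv) to the set
  \<open>A = {x\<^sub>n}\<close>: a sequence in \<open>A\<close> has
  a subsequence that is either constant or a subsequence of \<open>(x\<^sub>n)\<close>, whence \<open>\<beta>\<^sub>w(A) \<le> \<delta>(x\<^sub>n)\<close>
  (\<open>beta_w_range_le_delta\<close>).

  The remaining implication, from (ii) to (i) with constant \<open>2c\<close>, rests on
  \<open>subseq_setdist_clust_ge_half\<close>: if \<open>z\<close> is a weak-star cluster point of \<open>(x\<^sub>n)\<close> with distance
  greater than \<open>d\<close> from \<open>X\<close>, then some subsequence has all its cluster points at distance at least
  \<open>d/2\<close> from \<open>X\<close>. The subsequence \<open>(x(r\<^sub>k))\<close> is built together with functionals \<open>f\<^sub>m\<close> in the dual unit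
  ball such that \<open>Re z(f\<^sub>m) > d\<close>, \<open>f\<^sub>m(x(r\<^sub>k)) \<rightarrow> 0\<close> as \<open>m\<close> grows, and
  \<open>f\<^sub>m(x(r\<^sub>k)) \<rightarrow> z(f\<^sub>m)\<close> as \<open>k\<close> grows. Let \<open>y\<close> be a cluster point of the subsequence, \<open>f\<close> a
  weak-star cluster point of \<open>(f\<^sub>m)\<close>, and \<open>a\<close> in \<open>X\<close>. Then \<open>y(f\<^sub>m) = z(f\<^sub>m)\<close> and \<open>y(f) = 0\<close>, so
  \<open>(y - a)(f\<^sub>m - f)\<close> has real part above \<open>d\<close> up to a term \<open>(f\<^sub>m - f)(a)\<close>, which is small for
  infinitely many \<open>m\<close>; since \<open>f\<^sub>m - f\<close> has norm at most 2, \<open>y - a\<close> has norm at least \<open>d/2\<close>.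

  The functionals \<open>f\<^sub>m\<close> come from a form of Helly's theorem (\<open>helly\<close>). It needs no Hahn--Banach
  theorem, only the separation of a point from a convex set in finitely many dimensions, which is
  obtained by nearly minimising a sum of squares (\<open>convex_approx_finitely_many_functionals\<close>).

  Real and complex scalars are treated together in the locale \<open>canonical_embedding\<close>.
\<close>

section \<open>Approximation by points of a convex set\<close>

text \<open>A point \<open>p\<close> in a finite-dimensional space that cannot be strictly separated from the bounded
  convex set \<open>{(\<phi>\<^sub>i f)\<^sub>i | f \<in> C}\<close> lies in its closure.\<close>

lemma convex_approx_finitely_many_functionals:
  fixes \<phi> :: "'i \<Rightarrow> 'v::real_vector \<Rightarrow> real"
  assumes "finite I" "convex C"
    and lin: "\<And>i. i \<in> I \<Longrightarrow> linear (\<phi> i)"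
    and bound: "\<And>i f. i \<in> I \<Longrightarrow> f \<in> C \<Longrightarrow> \<bar>\<phi> i f\<bar> \<le> D"
    and nonsep: "\<And>a. \<exists>f\<in>C. (\<Sum>i\<in>I. a i * p i) \<le> (\<Sum>i\<in>I. a i * \<phi> i f)"
    and "e > 0"
  shows "\<exists>f\<in>C. \<forall>i\<in>I. \<bar>\<phi> i f - p i\<bar> < e"
proof (rule ccontr)
  assume neg: "\<not> ?thesis"
  define q where "q f = (\<Sum>i\<in>I. (\<phi> i f - p i)\<^sup>2)" for f
  define m where "m = (INF f\<in>C. q f)"
  have "C \<noteq> {}" using nonsep by blast
  have q_ge: "e\<^sup>2 \<le> q f" if "f \<in> C" for f
  proof -
    obtain i where i: "i \<in> I" "e \<le> \<bar>\<phi> i f - p i\<bar>"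
      using neg \<open>f \<in> C\<close> by (meson not_le)
    have "e\<^sup>2 \<le> (\<phi> i f - p i)\<^sup>2"
      using i \<open>e > 0\<close> by (metis abs_le_square_iff abs_of_pos)
    also have "\<dots> \<le> q f"
      unfolding q_def by (rule member_le_sum) (use i \<open>finite I\<close> in auto)
    finally show ?thesis .
  qed
  then have m_ge: "e\<^sup>2 \<le> m"
    unfolding m_def using \<open>C \<noteq> {}\<close> by (intro cINF_greatest)
  have m_pos: "m > 0"
    using m_ge \<open>e > 0\<close> by (smt (verit) zero_less_power)
  have bdd: "bdd_below (q ` C)"
    using q_ge by (auto intro!: bdd_belowI[of _ "e\<^sup>2"])
  have m_le: "m \<le> q f" if "f \<in> C" for f
    unfolding m_def by (rule cINF_lower[OF bdd that])
  define E where "E = max m (\<Sum>i\<in>I. (2 * D)\<^sup>2)"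
  have E: "E \<ge> m" "E > 0" using m_pos by (auto simp: E_def)
  \<comment> \<open>Move from a near minimiser \<open>f0\<close> towards a point \<open>f\<close> given by non-separation in the
    direction \<open>p - \<phi>(f0)\<close>. The value of \<open>q\<close> along the segment is at most \<open>q f0 - 2 t m + t\<^sup>2 E\<close>;
    at \<open>t = m / E\<close> this is \<open>q f0 - m\<^sup>2 / E < m\<close>, below the infimum.\<close>
  have "m < m + m\<^sup>2 / E" using m_pos E by simp
  then obtain f0 where f0: "f0 \<in> C" "q f0 < m + m\<^sup>2 / E"
    unfolding m_def using cINF_less_iff[OF \<open>C \<noteq> {}\<close> bdd] by blast
  obtain f where f: "f \<in> C"
    "(\<Sum>i\<in>I. (p i - \<phi> i f0) * p i) \<le> (\<Sum>i\<in>I. (p i - \<phi> i f0) * \<phi> i f)"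
    using nonsep[of "\<lambda>i. p i - \<phi> i f0"] by auto
  define t where "t = m / E"
  have t: "0 < t" "t \<le> 1" using E m_pos by (auto simp: t_def)
  define g where "g = (1 - t) *\<^sub>R f0 + t *\<^sub>R f"
  have g: "g \<in> C"
    unfolding g_def using \<open>convex C\<close> f0 f t by (auto intro: convexD)
  have \<phi>g: "\<phi> i g = \<phi> i f0 + t * (\<phi> i f - \<phi> i f0)" if "i \<in> I" for i
    unfolding g_def linear_add[OF lin[OF that]] linear_scale[OF lin[OF that]]
    by (simp add: algebra_simps)
  have "q g = (\<Sum>i\<in>I. (\<phi> i f0 - p i)\<^sup>2 - 2 * t * ((p i - \<phi> i f0) * (\<phi> i f - \<phi> i f0))
        + t\<^sup>2 * (\<phi> i f - \<phi> i f0)\<^sup>2)"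
    unfolding q_def by (intro sum.cong refl) (simp add: \<phi>g power2_eq_square algebra_simps)
  also have "\<dots> = q f0 - 2 * t * (\<Sum>i\<in>I. (p i - \<phi> i f0) * (\<phi> i f - \<phi> i f0))
        + t\<^sup>2 * (\<Sum>i\<in>I. (\<phi> i f - \<phi> i f0)\<^sup>2)"
    by (simp add: q_def sum.distrib sum_subtractf sum_distrib_left)
  finally have qg: "q g = \<dots>" .
  have "(\<Sum>i\<in>I. (p i - \<phi> i f0) * (\<phi> i f - \<phi> i f0))
      = (\<Sum>i\<in>I. (p i - \<phi> i f0) * \<phi> i f) - (\<Sum>i\<in>I. (p i - \<phi> i f0) * p i) + q f0"
    by (simp add: q_def power2_eq_square sum_subtractf[symmetric] sum.distrib[symmetric] algebra_simps)
  then have "m \<le> (\<Sum>i\<in>I. (p i - \<phi> i f0) * (\<phi> i f - \<phi> i f0))"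
    using f m_le[OF f0(1)] by linarith
  then have 1: "2 * t * m \<le> 2 * t * (\<Sum>i\<in>I. (p i - \<phi> i f0) * (\<phi> i f - \<phi> i f0))"
    using t by simp
  have "(\<phi> i f - \<phi> i f0)\<^sup>2 \<le> (2 * D)\<^sup>2" if "i \<in> I" for i
  proof (rule abs_le_square_iff[THEN iffD1])
    show "\<bar>\<phi> i f - \<phi> i f0\<bar> \<le> \<bar>2 * D\<bar>"
      using bound[OF that f(1)] bound[OF that f0(1)] by linarith
  qed
  then have "(\<Sum>i\<in>I. (\<phi> i f - \<phi> i f0)\<^sup>2) \<le> (\<Sum>i\<in>I. (2 * D)\<^sup>2)"
    by (rule sum_mono)
  then have "(\<Sum>i\<in>I. (\<phi> i f - \<phi> i f0)\<^sup>2) \<le> E"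
    by (simp add: E_def)
  then have 2: "t\<^sup>2 * (\<Sum>i\<in>I. (\<phi> i f - \<phi> i f0)\<^sup>2) \<le> t\<^sup>2 * E"
    by (intro mult_left_mono) auto
  have 3: "2 * t * m = 2 * (m\<^sup>2 / E)" "t\<^sup>2 * E = m\<^sup>2 / E"
    using E by (auto simp: t_def power2_eq_square)
  have "q g < m"
    using qg 1 2 3 f0(2) by linarith
  with m_le[OF g] show False by simp
qed

section \<open>Oscillation of scalar sequences\<close>

lemma tail_bounded: "bounded (range x) \<Longrightarrow> bounded {x k |k. k \<ge> (n::nat)}"
  by (erule bounded_subset) auto

lemma ca_bdd_below:
  assumes "bounded (range x)"
  shows "bdd_below (range (\<lambda>n::nat. diameter {x k |k. k \<ge> n}))"
  using diameter_ge_0[OF tail_bounded[OF assms]] by (auto intro!: bdd_belowI[of _ 0])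

lemma ca_nonneg: "bounded (range x) \<Longrightarrow> 0 \<le> ca x"
  unfolding ca_def by (intro cINF_greatest diameter_ge_0 tail_bounded) auto

lemma ca_le_diameter_range:
  assumes "bounded (range x)"
  shows "ca x \<le> diameter (range x)"
proof -
  have "ca x \<le> diameter {x k |k. k \<ge> 0}"
    unfolding ca_def by (rule cINF_lower[OF ca_bdd_below[OF assms]]) simp
  then show ?thesis by (simp add: full_SetCompr_eq)
qed

lemma ca_subseq_le:
  assumes "bounded (range x)" "strict_mono (r :: nat \<Rightarrow> nat)"
  shows "ca (\<lambda>n. x (r n)) \<le> ca x"
  unfolding ca_def
proof (rule cINF_mono)
  have "bounded (range (\<lambda>n. x (r n)))"
    using assms(1) by (rule bounded_subset) auto
  then show "bdd_below (range (\<lambda>n. diameter {x (r k) |k. k \<ge> n}))"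
    by (rule ca_bdd_below)
  fix n :: nat
  have "{x (r k) |k. k \<ge> n} \<subseteq> {x k |k. k \<ge> n}"
    using seq_suble[OF assms(2)] le_trans by blast
  then show "\<exists>m\<in>UNIV. diameter {x (r k) |k. k \<ge> m} \<le> diameter {x k |k. k \<ge> n}"
    using diameter_subset[OF _ tail_bounded[OF assms(1)]] by blast
qed simp

lemma nat_seq_subseq_const_or_strict_mono:
  fixes s :: "nat \<Rightarrow> nat"
  obtains r :: "nat \<Rightarrow> nat" where "strict_mono r" "(\<exists>c. \<forall>n. s (r n) = c) \<or> strict_mono (s \<circ> r)"
proof (cases "finite (range s)")
  case True
  then obtain c where "infinite {n. s n = c}"
    using pigeonhole_infinite[of UNIV s] by auto
  then obtain r :: "nat \<Rightarrow> nat" where "strict_mono r" "\<forall>n. r n \<in> {n. s n = c}"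
    using infinite_enumerate by blast
  then show ?thesis by (intro that[of r]) auto
next
  case False
  have step: "\<exists>m'. m < m' \<and> s m < s m'" for m
  proof (rule ccontr)
    assume "\<not> ?thesis"
    then have "s k \<in> s ` {..m} \<union> {..s m}" for k
      by (cases "k \<le> m") (auto simp: not_le not_less)
    then have "range s \<subseteq> s ` {..m} \<union> {..s m}" by blast
    then show False using False finite_subset[of "range s"] by simp
  qed
  then obtain h where h: "\<And>m. m < h m \<and> s m < s (h m)" by metis
  define r where "r n = (h ^^ n) 0" for n
  have "\<forall>n. r n < r (Suc n) \<and> s (r n) < s (r (Suc n))"
    unfolding r_def funpow.simps comp_apply using h by blast
  then show ?thesis by (intro that[of r] disjI2) (simp_all add: strict_mono_Suc_iff)
qed

section \<open>The canonical embedding over either scalar field\<close>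

text \<open>The facts on a normed space, its dual and its bidual used below, over scalars \<open>'k\<close> that will be
  the reals or the complex numbers: \<open>ev\<close> and \<open>ev2\<close> are the evaluations of the dual and the bidual,
  \<open>J\<close> is the canonical embedding and \<open>re\<close> the real part. The map \<open>rot\<close> recovers the imaginary part
  of a functional from its real part: it is multiplication by \<open>-\<i>\<close> in the complex case and the
  identity in the real case. Linearity is over the reals. The two closedness assumptions, in the
  topology of pointwise convergence, are what remains of Banach--Alaoglu once Tychonoff's theorem is
  at hand.\<close>

locale canonical_embedding =
  fixes ev :: "'d::real_normed_vector \<Rightarrow> 'a::real_normed_vector \<Rightarrow> 'k::{real_normed_field, heine_borel}"
    and ev2 :: "'b::real_normed_vector \<Rightarrow> 'd \<Rightarrow> 'k"
    and J :: "'a \<Rightarrow> 'b"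
    and re :: "'k \<Rightarrow> real"
    and rot :: "'a \<Rightarrow> 'a"
  assumes linear_J: "linear J"
    and ev2_J: "ev2 (J x) f = ev f x"
    and linear_ev2: "linear (ev2 z)"
    and linear_ev2_left: "linear (\<lambda>z. ev2 z f)"
    and norm_ev_le: "norm (ev f x) \<le> norm f * norm x"
    and norm_ev2_le: "norm (ev2 z f) \<le> norm z * norm f"
    and norm_le_if_re: "(\<And>f. norm f \<le> 1 \<Longrightarrow> re (ev2 z f) \<le> M) \<Longrightarrow> norm z \<le> M"
    and linear_re: "linear re"
    and abs_re_le: "\<bar>re s\<bar> \<le> norm s"
    and norm_ev_le_re_rot: "norm (ev f x) \<le> \<bar>re (ev f x)\<bar> + \<bar>re (ev f (rot x))\<bar>"
    and closed_dual_ball: "closed (ev ` cball 0 M)"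
    and closed_bidual_ball: "closed (ev2 ` cball 0 M)"
begin

lemma norm_J_le: "norm (J x) \<le> norm x"
proof (rule norm_le_if_re)
  fix f :: 'd assume f: "norm f \<le> 1"
  have "re (ev2 (J x) f) \<le> norm (ev f x)"
    using abs_re_le[of "ev f x"] by (simp add: ev2_J)
  also have "\<dots> \<le> 1 * norm x"
    by (rule order_trans[OF norm_ev_le]) (intro mult_right_mono f, simp)
  finally show "re (ev2 (J x) f) \<le> norm x" by simp
qed

subsection \<open>Weak-star compactness and cluster points\<close>

lemma compact_if_closed_pointwise_bounded:
  fixes K :: "('u \<Rightarrow> 'k) set"
  assumes "closed K" "\<And>\<phi> u. \<phi> \<in> K \<Longrightarrow> norm (\<phi> u) \<le> B u"
  shows "compact K"
proof -
  have "compactin (product_topology (\<lambda>u. euclidean) UNIV) (PiE UNIV (\<lambda>u. cball (0::'k) (B u)))"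
    by (subst compactin_PiE) auto
  then have "compact (PiE UNIV (\<lambda>u. cball (0::'k) (B u)))"
    by (simp add: euclidean_product_topology)
  then have "compact (PiE UNIV (\<lambda>u. cball (0::'k) (B u)) \<inter> K)"
    using assms(1) by (rule compact_Int_closed)
  moreover have "PiE UNIV (\<lambda>u. cball (0::'k) (B u)) \<inter> K = K"
    using assms(2) by auto
  ultimately show ?thesis by simp
qed

lemma compact_dual_ball: "compact (ev ` cball 0 M)"
proof (rule compact_if_closed_pointwise_bounded[OF closed_dual_ball, where B = "\<lambda>x. M * norm x"])
  fix \<phi> x assume "\<phi> \<in> ev ` cball 0 M"
  then obtain f where "\<phi> = ev f" "norm f \<le> M" by auto
  then show "norm (\<phi> x) \<le> M * norm x"
    using norm_ev_le[of f x] by (meson mult_right_mono norm_ge_zero order_trans)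
qed

lemma compact_bidual_ball: "compact (ev2 ` cball 0 M)"
proof (rule compact_if_closed_pointwise_bounded[OF closed_bidual_ball, where B = "\<lambda>f. M * norm f"])
  fix \<phi> f assume "\<phi> \<in> ev2 ` cball 0 M"
  then obtain z where "\<phi> = ev2 z" "norm z \<le> M" by auto
  then show "norm (\<phi> f) \<le> M * norm f"
    using norm_ev2_le[of z f] by (meson mult_right_mono norm_ge_zero order_trans)
qed

lemma compact_cluster_point:
  fixes K :: "('u \<Rightarrow> 'k) set"
  assumes "compact K" "\<And>n. g n \<in> K"
  shows "\<exists>\<phi>\<in>K. \<forall>V. open V \<and> \<phi> \<in> V \<longrightarrow> (\<exists>\<^sub>F n in sequentially. g n \<in> V)"
proof -
  have "filtermap g sequentially \<noteq> bot"
    by (simp add: filtermap_bot_iff)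
  moreover have "eventually (\<lambda>\<phi>. \<phi> \<in> K) (filtermap g sequentially)"
    using assms(2) by (simp add: eventually_filtermap)
  ultimately obtain \<phi> where \<phi>: "\<phi> \<in> K" "inf (nhds \<phi>) (filtermap g sequentially) \<noteq> bot"
    using assms(1) unfolding compact_filter by blast
  have "\<exists>\<^sub>F n in sequentially. g n \<in> V" if "open V" "\<phi> \<in> V" for V
  proof (rule ccontr)
    assume "\<not> ?thesis"
    then have "eventually (\<lambda>\<psi>. \<psi> \<notin> V) (filtermap g sequentially)"
      by (simp add: frequently_def eventually_filtermap)
    moreover have "eventually (\<lambda>\<psi>. \<psi> \<in> V) (nhds \<phi>)"
      using that by (rule eventually_nhds_in_open)
    ultimately have "eventually (\<lambda>_. False) (inf (nhds \<phi>) (filtermap g sequentially))"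
      unfolding eventually_inf by blast
    with \<phi>(2) show False by (simp add: trivial_limit_def)
  qed
  with \<phi>(1) show ?thesis by blast
qed

lemma clust_iff:
  "z \<in> clust ev2 J x \<longleftrightarrow>
    (\<forall>V. open V \<and> ev2 z \<in> V \<longrightarrow> (\<exists>\<^sub>F n in sequentially. ev2 (J (x n)) \<in> V))"
  unfolding clust_def weak_star_topology_def openin_pullback_topology by auto

lemma open_pointwise_nhd:
  fixes \<phi> :: "'u \<Rightarrow> 'k"
  assumes "finite S"
  shows "open {\<psi>. \<forall>u\<in>S. norm (\<psi> u - \<phi> u) < e}"
proof -
  have "open {\<psi>. norm (\<psi> u - \<phi> u) < e}" for u
    by (intro open_Collect_less continuous_intros continuous_on_product_coordinates)
  moreover have "{\<psi>. \<forall>u\<in>S. norm (\<psi> u - \<phi> u) < e} = (\<Inter>u\<in>S. {\<psi>. norm (\<psi> u - \<phi> u) < e})"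
    by auto
  ultimately show ?thesis using assms by auto
qed

lemma clust_approx:
  assumes "z \<in> clust ev2 J x" "finite S" "e > 0"
  shows "\<exists>\<^sub>F n in sequentially. \<forall>f\<in>S. norm (ev f (x n) - ev2 z f) < e"
  using assms(1)[unfolded clust_iff, rule_format, of "{\<psi>. \<forall>f\<in>S. norm (\<psi> f - ev2 z f) < e}"]
    open_pointwise_nhd[OF assms(2)] assms(3) by (simp add: ev2_J)

lemma clust_nonempty:
  assumes "bounded (range x)"
  shows "clust ev2 J x \<noteq> {}"
proof -
  obtain M where M: "\<And>n. norm (x n) \<le> M"
    using assms by (auto simp: bounded_iff)
  have "ev2 (J (x n)) \<in> ev2 ` cball 0 M" for n
    using norm_J_le[of "x n"] M[of n] by (intro imageI) simp
  from compact_cluster_point[of "ev2 ` cball 0 M" "\<lambda>n. ev2 (J (x n))", OF compact_bidual_ball this]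
  show ?thesis
    unfolding clust_iff[symmetric] by (auto simp flip: clust_iff)
qed

lemma clust_eq_limit:
  assumes "z \<in> clust ev2 J x" "(\<lambda>n. ev f (x n)) \<longlonglongrightarrow> l"
  shows "ev2 z f = l"
proof (rule ccontr)
  assume ne: "ev2 z f \<noteq> l"
  define e where "e = norm (ev2 z f - l) / 2"
  have "e > 0" using ne by (simp add: e_def)
  have "eventually (\<lambda>n. norm (ev f (x n) - l) < e) sequentially"
    using tendstoD[OF assms(2) \<open>e > 0\<close>] by (simp add: dist_norm)
  with clust_approx[OF assms(1), of "{f}", OF _ \<open>e > 0\<close>]
  have "\<exists>\<^sub>F n in sequentially. norm (ev f (x n) - ev2 z f) < e \<and> norm (ev f (x n) - l) < e"
    by (simp add: frequently_eventually_conj conj_commute)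
  then obtain n where "norm (ev f (x n) - ev2 z f) < e" "norm (ev f (x n) - l) < e"
    by (auto dest: frequently_ex)
  then have "norm (ev2 z f - l) < 2 * e"
    using norm_triangle_ineq4[of "ev f (x n) - l" "ev f (x n) - ev2 z f"] by (simp add: norm_minus_commute)
  then show False by (simp add: e_def)
qed

lemma norm_clust_le:
  assumes z: "z \<in> clust ev2 J x" and M: "\<And>n. norm (x n) \<le> M"
  shows "norm z \<le> M"
proof (rule norm_le_if_re, rule field_le_epsilon)
  fix f :: 'd and e :: real assume f: "norm f \<le> 1" and "e > 0"
  obtain n where n: "norm (ev f (x n) - ev2 z f) < e"
    using clust_approx[OF z, of "{f}", OF _ \<open>e > 0\<close>] by (auto dest: frequently_ex)
  have "re (ev2 z f) \<le> norm (ev2 z f)" using abs_re_le[of "ev2 z f"] by linarith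
  also have "\<dots> \<le> norm (ev f (x n)) + e"
    using n norm_triangle_ineq2[of "ev2 z f" "ev f (x n)"] by (simp add: norm_minus_commute)
  also have "norm (ev f (x n)) \<le> 1 * M"
    using norm_ev_le[of f "x n"] mult_mono[OF f M[of n]] by simp
  finally show "re (ev2 z f) \<le> M + e" by simp
qed

lemma clust_subseq_subset:
  assumes "strict_mono r"
  shows "clust ev2 J (x \<circ> r) \<subseteq> clust ev2 J x"
proof
  fix z assume z: "z \<in> clust ev2 J (x \<circ> r)"
  show "z \<in> clust ev2 J x"
    unfolding clust_iff
  proof (intro allI impI)
    fix V assume "open V \<and> ev2 z \<in> V"
    then have *: "\<exists>\<^sub>F n in sequentially. ev2 (J (x (r n))) \<in> V"
      using z by (simp add: clust_iff)
    show "\<exists>\<^sub>F n in sequentially. ev2 (J (x n)) \<in> V"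
      unfolding frequently_sequentially
    proof
      fix N
      obtain n where "n \<ge> N" "ev2 (J (x (r n))) \<in> V"
        using * unfolding frequently_sequentially by blast
      then show "\<exists>n\<ge>N. ev2 (J (x n)) \<in> V"
        using seq_suble[OF assms, of n] order_trans by blast
    qed
  qed
qed

lemma setdist_clust_subseq_ge:
  assumes "bounded (range x)" "strict_mono r"
  shows "setdist (clust ev2 J x) (range J) \<le> setdist (clust ev2 J (x \<circ> r)) (range J)"
proof (rule setdist_subset_left)
  show "clust ev2 J (x \<circ> r) \<noteq> {}"
    using assms(1) by (intro clust_nonempty bounded_subset[OF assms(1)]) auto
qed (rule clust_subseq_subset[OF assms(2)])

lemma setdist_sing_clust_le:
  assumes "z \<in> clust ev2 J x" "\<And>n. norm (x n) \<le> M"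
  shows "setdist {z} (range J) \<le> M"
proof -
  have "setdist {z} (range J) \<le> dist z (J 0)"
    by (rule setdist_le_dist) auto
  also have "\<dots> = norm z" by (simp add: linear_0[OF linear_J])
  finally show ?thesis using norm_clust_le[OF assms] by linarith
qed

subsection \<open>The moduli\<close>

lemma range_ev_bounded:
  assumes "bounded (range x)"
  shows "bounded (range (\<lambda>n. ev f (x n)))"
proof -
  obtain M where M: "\<And>n. norm (x n) \<le> M"
    using assms by (auto simp: bounded_iff)
  have "norm (ev f (x n)) \<le> norm f * M" for n
    using norm_ev_le[of f "x n"] mult_left_mono[OF M[of n], of "norm f"] by simp
  then show ?thesis by (auto simp: bounded_iff)
qed

lemma ca_ev_le:
  assumes "\<And>n. norm (x n) \<le> M" "norm f \<le> 1"
  shows "ca (\<lambda>n. ev f (x n)) \<le> 2 * M"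
proof -
  have le: "norm (ev f (x n)) \<le> M" for n
    using norm_ev_le[of f "x n"] mult_mono[OF assms(2) assms(1)[of n]] by simp
  have "bounded (range x)" using assms(1) by (auto simp: bounded_iff)
  then have "ca (\<lambda>n. ev f (x n)) \<le> diameter (range (\<lambda>n. ev f (x n)))"
    by (intro ca_le_diameter_range range_ev_bounded)
  also have "\<dots> \<le> 2 * M"
  proof (rule diameter_le)
    fix s t assume "s \<in> range (\<lambda>n. ev f (x n))" "t \<in> range (\<lambda>n. ev f (x n))"
    then have "norm s \<le> M" "norm t \<le> M" using le by auto
    then show "norm (s - t) \<le> 2 * M"
      using norm_triangle_ineq4[of s t] by linarith
  qed simp
  finally show ?thesis .
qed

lemma delta_bdd_above:
  assumes "bounded (range x)"
  shows "bdd_above ((\<lambda>f. ca (\<lambda>n. ev f (x n))) ` cball 0 1)"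
proof -
  obtain M where M: "\<And>n. norm (x n) \<le> M"
    using assms by (auto simp: bounded_iff)
  show ?thesis
    using ca_ev_le[OF M] by (auto intro!: bdd_aboveI[of _ "2 * M"])
qed

lemma delta_le:
  assumes "\<And>n. norm (x n) \<le> M"
  shows "delta ev x \<le> 2 * M"
  unfolding delta_def using ca_ev_le[OF assms] by (intro cSUP_least) auto

lemma delta_nonneg:
  assumes "bounded (range x)"
  shows "0 \<le> delta ev x"
  unfolding delta_def
  by (rule cSUP_upper2[OF delta_bdd_above[OF assms], of 0])
    (auto intro: ca_nonneg range_ev_bounded assms)

lemma delta_subseq_le:
  assumes "bounded (range x)" "strict_mono r"
  shows "delta ev (x \<circ> r) \<le> delta ev x"
  unfolding delta_def
  by (rule cSUP_mono)
    (auto intro!: delta_bdd_above[OF assms(1)] ca_subseq_le assms(2) range_ev_bounded[OF assms(1)])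

lemma bounded_range_subseq: "bounded (range x) \<Longrightarrow> bounded (range (x \<circ> (r::nat\<Rightarrow>nat)))"
  by (erule bounded_subset) auto

lemma delta_const: "delta ev (\<lambda>n. a) = 0"
proof -
  have "ca (\<lambda>n. ev f a) = 0" for f
  proof -
    have "{ev f a |k. k \<ge> n} = {ev f a}" for n :: nat by auto
    then show ?thesis by (simp add: ca_def)
  qed
  then show ?thesis by (simp add: delta_def)
qed

lemma delta_sub_le:
  assumes "bounded (range x)" "strict_mono r"
  shows "delta_sub ev x \<le> delta ev (x \<circ> r)"
  unfolding delta_sub_def
proof (rule cINF_lower)
  show "bdd_below ((\<lambda>r. delta ev (x \<circ> r)) ` {r. strict_mono r})"
    using delta_nonneg[OF bounded_range_subseq[OF assms(1)]] by (auto intro!: bdd_belowI[of _ 0])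
qed (use assms in simp)

lemma delta_sub_le_delta: "bounded (range x) \<Longrightarrow> delta_sub ev x \<le> delta ev x"
  using delta_sub_le[of x id] by (simp add: strict_mono_def)

lemma beta_w_range_le_delta:
  assumes x: "bounded (range x)"
  shows "beta_w ev (range x) \<le> delta ev x"
  unfolding beta_w_def
proof (rule cSUP_least)
  show "{y. range y \<subseteq> range x} \<noteq> {}" by auto
  fix y :: "nat \<Rightarrow> 'a" assume "y \<in> {y. range y \<subseteq> range x}"
  then have "\<forall>n. \<exists>k. y n = x k" by blast
  then obtain s where "\<forall>n. y n = x (s n)" by metis
  then have y: "y = x \<circ> s" by auto
  have bdd: "bounded (range y)" unfolding y by (rule bounded_range_subseq[OF x])
  obtain r :: "nat \<Rightarrow> nat" where r: "strict_mono r" "(\<exists>c. \<forall>n. s (r n) = c) \<or> strict_mono (s \<circ> r)"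
    by (rule nat_seq_subseq_const_or_strict_mono)
  have "delta_sub ev y \<le> delta ev (y \<circ> r)" by (rule delta_sub_le[OF bdd r(1)])
  also have "\<dots> \<le> delta ev x"
    using r(2)
  proof
    assume "\<exists>c. \<forall>n. s (r n) = c"
    then obtain c where "\<And>n. s (r n) = c" by blast
    then have "y \<circ> r = (\<lambda>n. x c)" by (simp add: y fun_eq_iff)
    then show ?thesis using delta_nonneg[OF x] by (simp add: delta_const)
  next
    assume "strict_mono (s \<circ> r)"
    from delta_subseq_le[OF x this] show ?thesis by (simp add: y comp_assoc)
  qed
  finally show "delta_sub ev y \<le> delta ev x" .
qed

lemma setdist_clust_le_wck:
  assumes A: "bounded A" and x: "range x \<subseteq> A"
  shows "setdist (clust ev2 J x) (range J) \<le> wck ev2 J A"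
  unfolding wck_def
proof (rule cSUP_upper)
  obtain M where M: "\<And>a. a \<in> A \<Longrightarrow> norm a \<le> M"
    using A by (auto simp: bounded_iff)
  have "setdist (clust ev2 J y) (range J) \<le> M" if y: "range y \<subseteq> A" for y
  proof -
    obtain z where z: "z \<in> clust ev2 J y"
      using clust_nonempty[OF bounded_subset[OF A y]] by blast
    have "setdist (clust ev2 J y) (range J) \<le> setdist {z} (range J)"
      using z by (intro setdist_subset_left) auto
    also have "\<dots> \<le> M"
      by (rule setdist_sing_clust_le[OF z]) (use M y in auto)
    finally show ?thesis .
  qed
  then show "bdd_above ((\<lambda>x. setdist (clust ev2 J x) (range J)) ` {x. range x \<subseteq> A})"
    by (auto intro!: bdd_aboveI[of _ M])
qed (use x in simp)

lemma delta_sub_le_beta_w: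
  assumes A: "bounded A" and x: "range x \<subseteq> A"
  shows "delta_sub ev x \<le> beta_w ev A"
  unfolding beta_w_def
proof (rule cSUP_upper)
  obtain M where M: "\<And>a. a \<in> A \<Longrightarrow> norm a \<le> M"
    using A by (auto simp: bounded_iff)
  have "delta_sub ev y \<le> 2 * M" if y: "range y \<subseteq> A" for y
  proof -
    have "delta_sub ev y \<le> delta ev y"
      by (rule delta_sub_le_delta[OF bounded_subset[OF A y]])
    also have "\<dots> \<le> 2 * M" by (rule delta_le) (use M y in auto)
    finally show ?thesis .
  qed
  then show "bdd_above (delta_sub ev ` {x. range x \<subseteq> A})"
    by (auto intro!: bdd_aboveI[of _ "2 * M"])
qed (use x in simp)

subsection \<open>Functionals separating a bidual element from the space\<close>

text \<open>If no such \<open>f\<close> existed, a real combination of \<open>z\<close> and the points of \<open>S\<close> would stay below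
  its prescribed value on the whole dual ball. The coefficient of \<open>z\<close> is then positive, and after
  division by it the combination is an element of \<open>z + X\<close> of norm at most \<open>d\<close>.\<close>

lemma helly_re:
  assumes "finite S" "0 \<le> d" and far: "\<And>a. d < norm (z - J a)" and "e > 0"
  shows "\<exists>f. norm f \<le> 1 \<and> (\<forall>a\<in>S. \<bar>re (ev f a)\<bar> < e) \<and> \<bar>re (ev2 z f) - d\<bar> < e"
proof -
  define I where "I = insert z (J ` S)"
  have znot: "z \<notin> J ` S"
  proof
    assume "z \<in> J ` S"
    then obtain a where "z = J a" by blast
    with far[of a] \<open>0 \<le> d\<close> show False by simp
  qed
  \<comment> \<open>The elements of the bidual in \<open>I\<close> index the functionals; the target values are \<open>d\<close> at \<open>z\<close>
    and \<open>0\<close> at the points of \<open>S\<close>.\<close>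
  define p where "p w = (if w = z then d else 0)" for w
  define \<phi> where "\<phi> w f = re (ev2 w f)" for w f
  have finI: "finite I" using \<open>finite S\<close> by (simp add: I_def)
  have lin: "linear (\<phi> w)" for w
    unfolding \<phi>_def using linear_compose[OF linear_ev2 linear_re] by (simp add: o_def)
  have linw: "linear (\<lambda>w. \<phi> w f)" for f
    unfolding \<phi>_def using linear_compose[OF linear_ev2_left linear_re] by (simp add: o_def)
  have "\<exists>f\<in>cball 0 1. \<forall>w\<in>I. \<bar>\<phi> w f - p w\<bar> < e"
  proof (rule convex_approx_finitely_many_functionals[OF finI _ lin _ _ \<open>e > 0\<close>])
    show "convex (cball (0::'d) 1)" by (rule convex_cball)
    show "\<bar>\<phi> w f\<bar> \<le> (\<Sum>w\<in>I. norm w)" if "w \<in> I" "f \<in> cball 0 1" for w f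
    proof -
      have "\<bar>\<phi> w f\<bar> \<le> norm (ev2 w f)" unfolding \<phi>_def by (rule abs_re_le)
      also have "\<dots> \<le> norm w * norm f" by (rule norm_ev2_le)
      also have "\<dots> \<le> norm w * 1" using that by (intro mult_left_mono) auto
      also have "\<dots> \<le> (\<Sum>w\<in>I. norm w)"
        using member_le_sum[OF that(1), of norm] finI by simp
      finally show ?thesis .
    qed
    fix a
    show "\<exists>f\<in>cball 0 1. (\<Sum>w\<in>I. a w * p w) \<le> (\<Sum>w\<in>I. a w * \<phi> w f)"
    proof (rule ccontr)
      assume "\<not> ?thesis"
      then have neg: "(\<Sum>w\<in>I. a w * \<phi> w f) < (\<Sum>w\<in>I. a w * p w)" if "norm f \<le> 1" for f
        using that by force
      have "(\<Sum>w\<in>J ` S. a w * p w) = 0"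
        using znot by (intro sum.neutral) (auto simp: p_def)
      then have sp: "(\<Sum>w\<in>I. a w * p w) = a z * d"
        using znot \<open>finite S\<close> by (simp add: I_def p_def)
      have "0 < a z * d"
        using neg[of 0] unfolding sp by (simp add: linear_0[OF lin])
      then have az: "a z > 0"
        using \<open>0 \<le> d\<close> by (simp add: zero_less_mult_iff)
      define v where "v = (\<Sum>w\<in>J ` S. a w *\<^sub>R w)"
      have "v \<in> range J"
        unfolding v_def
        by (intro subspace_sum subspace_scale linear_subspace_image[OF linear_J]) auto
      then have "(- 1 / a z) *\<^sub>R v \<in> range J"
        by (intro subspace_scale linear_subspace_image[OF linear_J]) auto
      then obtain b where b: "J b = (- 1 / a z) *\<^sub>R v" by force
      have "norm (z - J b) \<le> d"
      proof (rule norm_le_if_re)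
        fix f :: 'd assume f: "norm f \<le> 1"
        have "(\<Sum>w\<in>I. a w * \<phi> w f) = a z * \<phi> z f + (\<Sum>w\<in>J ` S. a w * \<phi> w f)"
          using znot \<open>finite S\<close> by (simp add: I_def)
        also have "(\<Sum>w\<in>J ` S. a w * \<phi> w f) = \<phi> v f"
          by (simp add: v_def linear_sum[OF linw] linear_scale[OF linw])
        finally have "a z * \<phi> z f + \<phi> v f < a z * d"
          using neg[OF f] sp by simp
        moreover have "\<phi> (z - J b) f = \<phi> z f + \<phi> v f / a z"
          by (simp add: b linear_add[OF linw] linear_scale[OF linw])
        ultimately have "a z * \<phi> (z - J b) f < a z * d"
          using az by (simp add: distrib_left)
        then show "re (ev2 (z - J b) f) \<le> d"
          using az by (simp add: \<phi>_def)
      qed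
      with far[of b] show False by simp
    qed
  qed
  then obtain f where f: "norm f \<le> 1" "\<And>w. w \<in> I \<Longrightarrow> \<bar>\<phi> w f - p w\<bar> < e"
    by auto
  have "\<bar>re (ev f a)\<bar> < e" if "a \<in> S" for a
  proof -
    have "J a \<noteq> z" using znot that by auto
    then show ?thesis
      using f(2)[of "J a"] that by (simp add: I_def p_def \<phi>_def ev2_J)
  qed
  moreover have "\<bar>re (ev2 z f) - d\<bar> < e"
    using f(2)[of z] by (simp add: I_def p_def \<phi>_def)
  ultimately show ?thesis using f(1) by blast
qed

lemma helly:
  assumes "finite S" "0 \<le> d" "d < setdist {z} (range J)" "e > 0"
  shows "\<exists>f. norm f \<le> 1 \<and> (\<forall>a\<in>S. norm (ev f a) < e) \<and> d < re (ev2 z f)"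
proof -
  \<comment> \<open>Aiming at a slightly larger value \<open>d'\<close> makes the final inequality strict.\<close>
  obtain d' where d': "d < d'" "d' < setdist {z} (range J)"
    using assms(3) dense by blast
  have far: "d' < norm (z - J a)" for a
    using setdist_le_dist[of z "{z}" "J a" "range J"] d'(2) by (simp add: dist_norm)
  have "\<exists>f. norm f \<le> 1 \<and> (\<forall>a\<in>S \<union> rot ` S. \<bar>re (ev f a)\<bar> < min (e / 2) (d' - d))
      \<and> \<bar>re (ev2 z f) - d'\<bar> < min (e / 2) (d' - d)"
    by (rule helly_re) (use assms d' far in auto)
  then obtain f where f: "norm f \<le> 1" "\<And>a. a \<in> S \<union> rot ` S \<Longrightarrow> \<bar>re (ev f a)\<bar> < e / 2"
    "\<bar>re (ev2 z f) - d'\<bar> < d' - d"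
    by auto
  have "norm (ev f a) < e" if "a \<in> S" for a
    using norm_ev_le_re_rot[of f a] f(2)[of a] f(2)[of "rot a"] that by auto
  moreover have "d < re (ev2 z f)" using f(3) by linarith
  ultimately show ?thesis using f(1) by blast
qed

text \<open>The factor 2 in the proposition is lost here, in the bound \<open>norm (F m - f) \<le> 2\<close>.\<close>

lemma subseq_setdist_clust_ge_half:
  assumes x: "bounded (range x)" and z: "z \<in> clust ev2 J x"
    and d: "0 \<le> d" "d < setdist {z} (range J)"
  obtains r where "strict_mono r" "d / 2 \<le> setdist (clust ev2 J (x \<circ> r)) (range J)"
proof -
  \<comment> \<open>\<open>P g m (f, n)\<close>: the functional \<open>f\<close> and the index \<open>n\<close> are admissible at step \<open>m\<close>, when \<open>g\<close>
    holds the earlier choices. First \<open>f\<close> is chosen, nearly vanishing at the selected terms;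
    then \<open>n\<close>, such that the term \<open>x n\<close> nearly agrees with \<open>z\<close> on all functionals chosen so far,
    \<open>f\<close> included.\<close>
  define P where "P g m u \<longleftrightarrow> norm (fst u) \<le> 1
      \<and> (\<forall>k<m. norm (ev (fst u) (x (snd (g k)))) < inverse (real (Suc m)))
      \<and> d < re (ev2 z (fst u))
      \<and> (\<forall>k<m. snd (g k) < snd u)
      \<and> (\<forall>f\<in>insert (fst u) ((\<lambda>k. fst (g k)) ` {..<m}).
           norm (ev f (x (snd u)) - ev2 z f) < inverse (real (Suc m)))"
    for g :: "nat \<Rightarrow> 'd \<times> nat" and m u
  have "\<exists>g. \<forall>m. P g m (g m)"
  proof (rule dependent_wellorder_choice)
    show "P g m u = P h m u" if "\<And>k. k < m \<Longrightarrow> g k = h k" for g h m u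
      using that by (simp add: P_def)
    fix m :: nat and g :: "nat \<Rightarrow> 'd \<times> nat"
    have "\<exists>f. norm f \<le> 1 \<and> (\<forall>a\<in>(\<lambda>k. x (snd (g k))) ` {..<m}. norm (ev f a) < inverse (real (Suc m)))
        \<and> d < re (ev2 z f)"
      by (rule helly) (use d in auto)
    then obtain f where f: "norm f \<le> 1" "\<forall>k<m. norm (ev f (x (snd (g k)))) < inverse (real (Suc m))"
      "d < re (ev2 z f)" by auto
    have "\<exists>\<^sub>F n in sequentially. \<forall>h\<in>insert f ((\<lambda>k. fst (g k)) ` {..<m}).
        norm (ev h (x n) - ev2 z h) < inverse (real (Suc m))"
      by (rule clust_approx[OF z]) auto
    then obtain n where n: "n \<ge> Suc (\<Sum>k<m. snd (g k))"
      "\<forall>h\<in>insert f ((\<lambda>k. fst (g k)) ` {..<m}). norm (ev h (x n) - ev2 z h) < inverse (real (Suc m))"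
      unfolding frequently_sequentially by blast
    have "snd (g k) < n" if "k < m" for k
      using n(1) member_le_sum[of k "{..<m}" "\<lambda>k. snd (g k)"] that by simp
    then have "P g m (f, n)" using f n by (simp add: P_def)
    then show "\<exists>u. P g m u" by blast
  qed
  then obtain g where g: "\<And>m. P g m (g m)" by blast
  define F where "F m = fst (g m)" for m
  define r where "r m = snd (g m)" for m
  have F1: "norm (F m) \<le> 1" and Fd: "d < re (ev2 z (F m))" for m
    using g[of m] by (simp_all add: P_def F_def)
  have Fx: "norm (ev (F m) (x (r k))) < inverse (real (Suc m))" if "k < m" for k m
    using g[of m] that by (simp add: P_def F_def r_def)
  have Fz: "norm (ev (F m) (x (r k)) - ev2 z (F m)) < inverse (real (Suc k))" if "m \<le> k" for k m
    using g[of k] that by (cases "m = k") (auto simp: P_def F_def r_def)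
  have r: "strict_mono r"
    unfolding strict_mono_def using g by (auto simp: P_def r_def)
  have inv0: "(\<lambda>n. inverse (real (Suc n))) \<longlonglongrightarrow> 0"
    by (rule LIMSEQ_inverse_real_of_nat)
  have "\<exists>\<phi>\<in>ev ` cball 0 1. \<forall>V. open V \<and> \<phi> \<in> V \<longrightarrow> (\<exists>\<^sub>F m in sequentially. ev (F m) \<in> V)"
    by (rule compact_cluster_point[OF compact_dual_ball]) (use F1 in auto)
  then obtain f where f: "norm f \<le> 1"
    "\<And>V. open V \<Longrightarrow> ev f \<in> V \<Longrightarrow> \<exists>\<^sub>F m in sequentially. ev (F m) \<in> V" by auto
  have f_close: "\<exists>\<^sub>F m in sequentially. norm (ev (F m) a - ev f a) < e" if "e > 0" for a e
    using f(2)[OF open_pointwise_nhd[of "{a}" "ev f" e]] that by simp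
  have fx: "ev f (x (r k)) = 0" for k
  proof (rule ccontr)
    assume ne: "ev f (x (r k)) \<noteq> 0"
    define e where "e = norm (ev f (x (r k))) / 2"
    have "e > 0" using ne by (simp add: e_def)
    have "eventually (\<lambda>m. inverse (real (Suc m)) < e) sequentially"
      using order_tendstoD(2)[OF inv0 \<open>e > 0\<close>] .
    moreover have "eventually (\<lambda>m. k < m) sequentially"
      by (rule eventually_gt_at_top)
    ultimately have "eventually (\<lambda>m. norm (ev (F m) (x (r k))) < e) sequentially"
      by eventually_elim (use Fx in force)
    with f_close[OF \<open>e > 0\<close>, of "x (r k)"]
    have "\<exists>\<^sub>F m in sequentially. norm (ev (F m) (x (r k)) - ev f (x (r k))) < e
        \<and> norm (ev (F m) (x (r k))) < e"
      by (simp add: frequently_eventually_conj conj_commute)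
    then obtain m where "norm (ev (F m) (x (r k)) - ev f (x (r k))) < e"
      "norm (ev (F m) (x (r k))) < e" by (auto dest: frequently_ex)
    then have "norm (ev f (x (r k))) < 2 * e"
      using norm_triangle_ineq2[of "ev f (x (r k))" "ev (F m) (x (r k))"]
      by (simp add: norm_minus_commute)
    then show False by (simp add: e_def)
  qed
  have "d / 2 \<le> setdist (clust ev2 J (x \<circ> r)) (range J)"
  proof (rule le_setdistI)
    show "clust ev2 J (x \<circ> r) \<noteq> {}"
      by (rule clust_nonempty[OF bounded_range_subseq[OF x]])
    fix y w assume y: "y \<in> clust ev2 J (x \<circ> r)" and "w \<in> range J"
    then obtain a where w: "w = J a" by blast
    have yF: "ev2 y (F m) = ev2 z (F m)" for m
    proof (rule clust_eq_limit[OF y])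
      have "eventually (\<lambda>k. norm (ev (F m) ((x \<circ> r) k) - ev2 z (F m)) \<le> inverse (real (Suc k))) sequentially"
        using eventually_ge_at_top[of m] by eventually_elim (use Fz in force)
      then have "(\<lambda>k. ev (F m) ((x \<circ> r) k) - ev2 z (F m)) \<longlonglongrightarrow> 0"
        using inv0 by (rule Lim_null_comparison)
      then show "(\<lambda>k. ev (F m) ((x \<circ> r) k)) \<longlonglongrightarrow> ev2 z (F m)"
        by (rule LIM_zero_cancel)
    qed
    have yf: "ev2 y f = 0"
      by (rule clust_eq_limit[OF y]) (simp add: fx)
    have "d \<le> 2 * norm (y - J a)"
    proof (rule field_le_epsilon)
      fix e :: real assume "e > 0"
      obtain m where m: "norm (ev (F m) a - ev f a) < e"
        using f_close[OF \<open>e > 0\<close>] by (auto dest: frequently_ex)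
      have "ev2 (y - J a) (F m - f) = ev2 z (F m) - (ev (F m) a - ev f a)"
        by (simp add: linear_diff[OF linear_ev2] linear_diff[OF linear_ev2_left] ev2_J yF yf)
      then have "re (ev2 (y - J a) (F m - f)) = re (ev2 z (F m)) - re (ev (F m) a - ev f a)"
        by (simp add: linear_diff[OF linear_re])
      moreover have "\<bar>re (ev (F m) a - ev f a)\<bar> < e"
        using abs_re_le m by (rule le_less_trans)
      moreover have "re (ev2 (y - J a) (F m - f)) \<le> 2 * norm (y - J a)"
      proof -
        have "re (ev2 (y - J a) (F m - f)) \<le> norm (ev2 (y - J a) (F m - f))"
          using abs_re_le abs_le_D1 by blast
        also have "\<dots> \<le> norm (y - J a) * norm (F m - f)" by (rule norm_ev2_le)
        also have "\<dots> \<le> norm (y - J a) * 2"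
          using norm_triangle_ineq4[of "F m" f] F1[of m] f(1) by (intro mult_left_mono) auto
        finally show ?thesis by simp
      qed
      ultimately show "d \<le> 2 * norm (y - J a) + e" using Fd[of m] by linarith
    qed
    then show "d / 2 \<le> dist y w" by (simp add: w dist_norm)
  qed simp
  with r show ?thesis using that by blast
qed

subsection \<open>The implications\<close>

lemma cond_i_imp_ii:
  assumes "cond_i ev ev2 J c"
  shows "cond_ii ev ev2 J c"
  unfolding cond_ii_def
proof (intro allI impI)
  fix x :: "nat \<Rightarrow> 'a" assume x: "bounded (range x)"
  obtain M where M: "\<And>n. norm (x n) \<le> M"
    using x by (auto simp: bounded_iff)
  obtain z where z: "z \<in> clust ev2 J x" using clust_nonempty[OF x] by blast
  have "setdist (clust ev2 J x) (range J) \<le> setdist {z} (range J)"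
    using z by (intro setdist_subset_left) auto
  also have "\<dots> \<le> excess (clust ev2 J x) (range J)"
    unfolding excess_def using z setdist_sing_clust_le[OF _ M]
    by (intro cSUP_upper) (auto intro!: bdd_aboveI[of _ M])
  also have "\<dots> \<le> c * delta ev x" using assms x by (simp add: cond_i_def)
  finally show "setdist (clust ev2 J x) (range J) \<le> c * delta ev x" .
qed

lemma cond_ii_imp_iii:
  assumes "c > 0" "cond_ii ev ev2 J c"
  shows "cond_iii ev ev2 J c"
  unfolding cond_iii_def
proof (intro allI impI)
  fix x :: "nat \<Rightarrow> 'a" assume x: "bounded (range x)"
  have "setdist (clust ev2 J x) (range J) / c \<le> delta_sub ev x"
    unfolding delta_sub_def
  proof (rule cINF_greatest)
    show "{r :: nat \<Rightarrow> nat. strict_mono r} \<noteq> {}" using strict_mono_id by blast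
    fix r :: "nat \<Rightarrow> nat" assume "r \<in> {r. strict_mono r}"
    then have "setdist (clust ev2 J x) (range J) \<le> setdist (clust ev2 J (x \<circ> r)) (range J)"
      using setdist_clust_subseq_ge[OF x] by simp
    also have "\<dots> \<le> c * delta ev (x \<circ> r)"
      using assms(2) bounded_range_subseq[OF x] unfolding cond_ii_def by blast
    finally show "setdist (clust ev2 J x) (range J) / c \<le> delta ev (x \<circ> r)"
      using assms(1) by (simp add: field_simps)
  qed
  then show "setdist (clust ev2 J x) (range J) \<le> c * delta_sub ev x"
    using assms(1) by (simp add: field_simps)
qed

lemma cond_iii_imp_iv:
  assumes "c > 0" "cond_iii ev ev2 J c"
  shows "cond_iv ev ev2 J c"
  unfolding cond_iv_def
proof (intro allI impI, elim conjE)
  fix A :: "'a set" assume "A \<noteq> {}" and A: "bounded A"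
  show "wck ev2 J A \<le> c * beta_w ev A"
    unfolding wck_def
  proof (rule cSUP_least)
    show "{x :: nat \<Rightarrow> 'a. range x \<subseteq> A} \<noteq> {}"
      using \<open>A \<noteq> {}\<close> by (auto intro: exI[of _ "\<lambda>n. SOME a. a \<in> A"] simp: some_in_eq)
    fix x :: "nat \<Rightarrow> 'a" assume "x \<in> {x. range x \<subseteq> A}"
    then have x: "range x \<subseteq> A" by simp
    have "setdist (clust ev2 J x) (range J) \<le> c * delta_sub ev x"
      using assms(2) bounded_subset[OF A x] by (simp add: cond_iii_def)
    also have "\<dots> \<le> c * beta_w ev A"
      using delta_sub_le_beta_w[OF A x] assms(1) by simp
    finally show "setdist (clust ev2 J x) (range J) \<le> c * beta_w ev A" .
  qed
qed

lemma cond_iv_imp_ii: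
  assumes "c > 0" "cond_iv ev ev2 J c"
  shows "cond_ii ev ev2 J c"
  unfolding cond_ii_def
proof (intro allI impI)
  fix x :: "nat \<Rightarrow> 'a" assume x: "bounded (range x)"
  have "setdist (clust ev2 J x) (range J) \<le> wck ev2 J (range x)"
    by (rule setdist_clust_le_wck[OF x]) simp
  also have "\<dots> \<le> c * beta_w ev (range x)"
    using assms(2) x by (simp add: cond_iv_def)
  also have "\<dots> \<le> c * delta ev x"
    using beta_w_range_le_delta[OF x] assms(1) by simp
  finally show "setdist (clust ev2 J x) (range J) \<le> c * delta ev x" .
qed

lemma cond_ii_imp_i_double:
  assumes "c > 0" "cond_ii ev ev2 J c"
  shows "cond_i ev ev2 J (2 * c)"
  unfolding cond_i_def
proof (intro allI impI)
  fix x :: "nat \<Rightarrow> 'a" assume x: "bounded (range x)"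
  show "excess (clust ev2 J x) (range J) \<le> 2 * c * delta ev x"
    unfolding excess_def
  proof (rule cSUP_least[OF clust_nonempty[OF x]], rule dense_le)
    fix z d assume z: "z \<in> clust ev2 J x" and d: "d < setdist {z} (range J)"
    show "d \<le> 2 * c * delta ev x"
    proof (cases "0 \<le> d")
      case True
      obtain r where r: "strict_mono r" "d / 2 \<le> setdist (clust ev2 J (x \<circ> r)) (range J)"
        by (rule subseq_setdist_clust_ge_half[OF x z True d])
      note r(2)
      also have "setdist (clust ev2 J (x \<circ> r)) (range J) \<le> c * delta ev (x \<circ> r)"
        using assms(2) bounded_range_subseq[OF x] unfolding cond_ii_def by blast
      also have "\<dots> \<le> c * delta ev x"
        using delta_subseq_le[OF x r(1)] assms(1) by simp
      finally show ?thesis by simp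
    next
      case False
      then show ?thesis
        using delta_nonneg[OF x] assms(1) by (smt (verit) mult_nonneg_nonneg)
    qed
  qed
qed

lemma cond_implications:
  assumes "c > 0"
  shows "(cond_i ev ev2 J c \<longrightarrow> cond_ii ev ev2 J c) \<and>
    (cond_ii ev ev2 J c \<longleftrightarrow> cond_iii ev ev2 J c) \<and>
    (cond_iii ev ev2 J c \<longleftrightarrow> cond_iv ev ev2 J c) \<and>
    (cond_iv ev ev2 J c \<longrightarrow> cond_i ev ev2 J (2 * c))"
  using cond_i_imp_ii cond_ii_imp_iii[OF assms] cond_iii_imp_iv[OF assms]
    cond_iv_imp_ii[OF assms] cond_ii_imp_i_double[OF assms] by blast

end

section \<open>Real and complex spaces\<close>

text \<open>The dual ball consists of the functions that are additive, homogeneous and bounded by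
  \<open>M * norm x\<close>, all of which are pointwise closed conditions.\<close>

lemma closed_blinfun_ball:
  "closed (blinfun_apply ` cball (0 :: 'v::real_normed_vector \<Rightarrow>\<^sub>L 'k::real_normed_vector) M)"
proof (cases "M \<ge> 0")
  case True
  have "blinfun_apply ` cball (0 :: 'v \<Rightarrow>\<^sub>L 'k) M =
    {\<phi>. (\<forall>x y. \<phi> (x + y) = \<phi> x + \<phi> y) \<and> (\<forall>r x. \<phi> (r *\<^sub>R x) = r *\<^sub>R \<phi> x) \<and> (\<forall>x. norm (\<phi> x) \<le> M * norm x)}"
    (is "_ = ?R")
  proof (intro set_eqI iffI)
    fix \<phi> assume "\<phi> \<in> blinfun_apply ` cball (0 :: 'v \<Rightarrow>\<^sub>L 'k) M"
    then obtain f :: "'v \<Rightarrow>\<^sub>L 'k" where f: "\<phi> = blinfun_apply f" "norm f \<le> M" by auto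
    have "norm (blinfun_apply f x) \<le> M * norm x" for x
      using norm_blinfun[of f x] f(2) by (meson mult_right_mono norm_ge_zero order_trans)
    then show "\<phi> \<in> ?R" by (simp add: f blinfun.add_right blinfun.scaleR_right)
  next
    fix \<phi> assume \<phi>: "\<phi> \<in> ?R"
    then have "bounded_linear \<phi>"
      by (intro bounded_linear_intro[of _ M]) (auto simp: mult.commute)
    then have "blinfun_apply (Blinfun \<phi>) = \<phi>" by (rule bounded_linear_Blinfun_apply)
    moreover from this have "norm (Blinfun \<phi>) \<le> M"
      using \<phi> True by (intro norm_blinfun_bound) auto
    ultimately show "\<phi> \<in> blinfun_apply ` cball (0 :: 'v \<Rightarrow>\<^sub>L 'k) M"
      by (intro image_eqI[of _ _ "Blinfun \<phi>"]) auto
  qed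
  moreover have "closed ?R"
    by (intro closed_Collect_conj closed_Collect_all closed_Collect_eq closed_Collect_le
        continuous_intros continuous_on_product_coordinates)
  ultimately show ?thesis by simp
qed simp

lemma norm_blinfun_real_le:
  fixes z :: "'v::real_normed_vector \<Rightarrow>\<^sub>L real"
  assumes "\<And>f. norm f \<le> 1 \<Longrightarrow> blinfun_apply z f \<le> M"
  shows "norm z \<le> M"
proof (rule norm_blinfun_bound)
  show "0 \<le> M" using assms[of 0] by simp
  fix f
  have *: "blinfun_apply z g \<le> M * norm g" for g
  proof (cases "g = 0")
    case False
    have "blinfun_apply z (g /\<^sub>R norm g) \<le> M"
      by (rule assms) (use False in simp)
    then show ?thesis using False by (simp add: blinfun.scaleR_right field_simps)
  qed simp
  show "norm (blinfun_apply z f) \<le> M * norm f"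
    using *[of f] *[of "- f"] by (simp add: blinfun.minus_right abs_le_iff)
qed

interpretation real_embedding:
  canonical_embedding blinfun_apply blinfun_apply "canon :: 'r::real_normed_vector \<Rightarrow> _" "\<lambda>s. s" "\<lambda>x. x"
proof
  show "canon (x + y) = canon x + canon y" for x y :: 'r
    by (rule blinfun_eqI) (simp add: canon.rep_eq blinfun.add_left blinfun.add_right)
  show "canon (t *\<^sub>R x) = t *\<^sub>R canon x" for t and x :: 'r
    by (rule blinfun_eqI) (simp add: canon.rep_eq blinfun.scaleR_left blinfun.scaleR_right)
  show "norm z \<le> M" if "\<And>f. norm f \<le> 1 \<Longrightarrow> blinfun_apply z f \<le> M"
    for z :: "('r \<Rightarrow>\<^sub>L real) \<Rightarrow>\<^sub>L real" and M
    using that by (rule norm_blinfun_real_le)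
  show "norm (blinfun_apply f x) \<le> norm f * norm x" for f :: "'r \<Rightarrow>\<^sub>L real" and x
    by (rule norm_blinfun)
  show "norm (blinfun_apply f x) \<le> norm f * norm x" for f :: "('r \<Rightarrow>\<^sub>L real) \<Rightarrow>\<^sub>L real" and x
    by (rule norm_blinfun)
qed (auto simp: canon.rep_eq blinfun.add_left blinfun.add_right blinfun.scaleR_left
      blinfun.scaleR_right closed_blinfun_ball)

lemma norm_cdual_apply_le: "norm (cdual_apply f x) \<le> norm f * norm x"
  by transfer (rule norm_blinfun)

lemma cdual_apply_scaleC_right: "cdual_apply f (a *\<^sub>C x) = a * cdual_apply f x"
  by transfer simp

lemma linear_cdual_apply: "linear (cdual_apply f)"
  by (rule linearI; transfer) (simp_all add: blinfun.add_right blinfun.scaleR_right)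

lemma closed_cdual_ball:
  "closed (cdual_apply ` cball (0 :: 'v::complex_normed_vector cdual) M)"
proof -
  have "cdual_apply ` cball (0 :: 'v cdual) M =
    blinfun_apply ` cball 0 M \<inter> {\<phi>. \<forall>a x. \<phi> (a *\<^sub>C x) = a * \<phi> x}" (is "_ = ?R")
  proof (intro set_eqI iffI)
    fix \<phi> assume "\<phi> \<in> cdual_apply ` cball (0 :: 'v cdual) M"
    then obtain f :: "'v cdual" where f: "\<phi> = cdual_apply f" "norm f \<le> M" by auto
    then show "\<phi> \<in> ?R"
      by (auto simp: cdual_apply.rep_eq norm_cdual.rep_eq cdual_apply_scaleC_right[unfolded cdual_apply.rep_eq])
  next
    fix \<phi> assume \<phi>: "\<phi> \<in> ?R"
    then obtain f where f: "\<phi> = blinfun_apply f" "norm f \<le> M" by auto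
    with \<phi> have "blinfun_of_cdual (Abs_cdual f) = f"
      by (intro Abs_cdual_inverse) auto
    then show "\<phi> \<in> cdual_apply ` cball (0 :: 'v cdual) M"
      using f by (intro image_eqI[of _ _ "Abs_cdual f"])
        (simp_all add: cdual_apply.rep_eq norm_cdual.rep_eq)
  qed
  moreover have "closed ?R"
    by (intro closed_Int closed_blinfun_ball closed_Collect_all closed_Collect_eq
        continuous_intros continuous_on_product_coordinates)
  ultimately show ?thesis by simp
qed

lemma norm_cdual_le:
  fixes z :: "'v::complex_normed_vector cdual"
  assumes "\<And>f. norm f \<le> 1 \<Longrightarrow> Re (cdual_apply z f) \<le> M"
  shows "norm z \<le> M"
proof -
  have M: "0 \<le> M" using assms[of 0] linear_0[OF linear_cdual_apply[of z]] by simp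
  have *: "norm (cdual_apply z f) \<le> M * norm f" for f
  proof (cases "cdual_apply z f = 0 \<or> f = 0")
    case True
    then show ?thesis using M linear_0[OF linear_cdual_apply[of z]] by auto
  next
    case False
    define w where "w = cdual_apply z f"
    \<comment> \<open>The scalar \<open>a\<close> normalises \<open>f\<close> and rotates the value \<open>w\<close> to the positive real axis.\<close>
    define a where "a = cnj w / of_real (cmod w * norm f)"
    have "w \<noteq> 0" using False by (simp add: w_def)
    have "norm (a *\<^sub>C f) \<le> 1"
      using False \<open>w \<noteq> 0\<close> by (simp add: norm_scaleC a_def norm_divide norm_mult)
    then have "Re (a * w) \<le> M"
      using assms[of "a *\<^sub>C f"] by (simp add: cdual_apply_scaleC_right w_def)
    moreover have "a * w = of_real (cmod w / norm f)"
      using \<open>w \<noteq> 0\<close> False complex_norm_square[of w]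
      by (simp add: a_def field_simps power2_eq_square)
    ultimately have "cmod w / norm f \<le> M" by (metis Re_complex_of_real)
    then show ?thesis using False by (simp add: w_def field_simps)
  qed
  show ?thesis
    using * by (simp add: norm_cdual.rep_eq cdual_apply.rep_eq M norm_blinfun_bound)
qed

interpretation complex_embedding:
  canonical_embedding cdual_apply cdual_apply "ccanon :: 'c::complex_normed_vector \<Rightarrow> _" Re
    "\<lambda>x. (- \<i>) *\<^sub>C x"
proof
  have ap: "cdual_apply (ccanon x) f = cdual_apply f x" for x :: 'c and f
    by (simp add: cdual_apply.rep_eq ccanon.rep_eq ccanon_blinfun.rep_eq)
  have eqI: "z = w" if "\<And>f. cdual_apply z f = cdual_apply w f" for z w :: "'c cdual cdual"
    using that by (metis blinfun_eqI blinfun_of_cdual_inject cdual_apply.rep_eq)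
  note left = bounded_linear.linear[OF bounded_linear_cdual_apply_left]
  show "cdual_apply (ccanon x) f = cdual_apply f x" for x :: 'c and f
    by (rule ap)
  show "ccanon (x + y) = ccanon x + ccanon y" for x y :: 'c
    by (rule eqI) (simp add: ap linear_add[OF left] linear_add[OF linear_cdual_apply])
  show "ccanon (t *\<^sub>R x) = t *\<^sub>R ccanon x" for t and x :: 'c
    by (rule eqI) (simp add: ap linear_scale[OF left] linear_scale[OF linear_cdual_apply])
  show "norm z \<le> M" if "\<And>f. norm f \<le> 1 \<Longrightarrow> Re (cdual_apply z f) \<le> M"
    for z :: "'c cdual cdual" and M
    using that by (rule norm_cdual_le)
  show "cmod (cdual_apply f x) \<le> \<bar>Re (cdual_apply f x)\<bar> + \<bar>Re (cdual_apply f ((- \<i>) *\<^sub>C x))\<bar>"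
    for f and x :: 'c
    using cmod_le[of "cdual_apply f x"] by (simp only: cdual_apply_scaleC_right) simp
  show "cdual_apply z (f + g) = cdual_apply z f + cdual_apply z g"
    "cdual_apply z (t *\<^sub>R f) = t *\<^sub>R cdual_apply z f"
    for z :: "'c cdual cdual" and f g t
    by (rule linear_add[OF linear_cdual_apply] linear_scale[OF linear_cdual_apply])+
  show "cdual_apply (z + w) f = cdual_apply z f + cdual_apply w f"
    "cdual_apply (t *\<^sub>R z) f = t *\<^sub>R cdual_apply z f"
    for z w :: "'c cdual cdual" and f t
    by (rule linear_add[OF left] linear_scale[OF left])+
  show "closed (cdual_apply ` cball (0 :: 'c cdual) M)"
    "closed (cdual_apply ` cball (0 :: 'c cdual cdual) M)" for M
    by (rule closed_cdual_ball)+
qed (rule norm_cdual_apply_le abs_Re_le_cmod | simp)+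

theorem proposition4p1:
  fixes c :: real
  assumes "c > 0"
  shows
    "((cond_i blinfun_apply blinfun_apply (canon :: 'r::banach \<Rightarrow> _) c \<longrightarrow>
        cond_ii blinfun_apply blinfun_apply (canon :: 'r::banach \<Rightarrow> _) c) \<and>
      (cond_ii blinfun_apply blinfun_apply (canon :: 'r::banach \<Rightarrow> _) c \<longleftrightarrow>
        cond_iii blinfun_apply blinfun_apply (canon :: 'r::banach \<Rightarrow> _) c) \<and>
      (cond_iii blinfun_apply blinfun_apply (canon :: 'r::banach \<Rightarrow> _) c \<longleftrightarrow>
        cond_iv blinfun_apply blinfun_apply (canon :: 'r::banach \<Rightarrow> _) c) \<and>
      (cond_iv blinfun_apply blinfun_apply (canon :: 'r::banach \<Rightarrow> _) c \<longrightarrow>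
        cond_i blinfun_apply blinfun_apply (canon :: 'r::banach \<Rightarrow> _) (2 * c))) \<and>
     ((cond_i cdual_apply cdual_apply (ccanon :: 'c::complex_banach \<Rightarrow> _) c \<longrightarrow>
        cond_ii cdual_apply cdual_apply (ccanon :: 'c::complex_banach \<Rightarrow> _) c) \<and>
      (cond_ii cdual_apply cdual_apply (ccanon :: 'c::complex_banach \<Rightarrow> _) c \<longleftrightarrow>
        cond_iii cdual_apply cdual_apply (ccanon :: 'c::complex_banach \<Rightarrow> _) c) \<and>
      (cond_iii cdual_apply cdual_apply (ccanon :: 'c::complex_banach \<Rightarrow> _) c \<longleftrightarrow>
        cond_iv cdual_apply cdual_apply (ccanon :: 'c::complex_banach \<Rightarrow> _) c) \<and>
      (cond_iv cdual_apply cdual_apply (ccanon :: 'c::complex_banach \<Rightarrow> _) c \<longrightarrow>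
        cond_i cdual_apply cdual_apply (ccanon :: 'c::complex_banach \<Rightarrow> _) (2 * c)))"
  using real_embedding.cond_implications[OF assms] complex_embedding.cond_implications[OF assms]
  by blast

end
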